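(* For each positive integer $h$ let $M=M(h)$ be an integer with $2\leq M$ and $M(h)=o(h/\log h)$. For every positive integer $d$ and every $\epsilon\in(0,1)$ there exists $h_0\in\mathbb{N}$ such that the following holds for all $h\geq h_0$. Let $r^*:=\sqrt{d}/(2h)$ and $r:=(1+\epsilon)r^*$. For each $s\in\{2,\dots,M\}$, let $k_s$ be the smallest integer satisfying both $\sqrt{d}\,s^{1-k_s}\leq r$ and $\sqrt{d}\,s^{-k_s}<\epsilon r^*/8$, and let $\mathcal{W}_s$ be the tessellation of $[0,1]^d$ into $s^{k_s d}$ congruent closed axis-parallel cubes. Let $m':=d\,k_2\,M$ (for $h\geq h_0$ one has $m'\leq h$). Let $(s_i)_{i=1}^h$ be a sequence with $s_i\in\{2,\dots,M\}$, let $T$ be the balanced tree over $(s_i)_{i=1}^h$, and let $s\in\{2,\dots,M\}$ be an integer appearing at least $d k_2$ times among $s_1,\dots,s_{m'}$ (such an integer exists by the pigeonhole principle). Let $\mathcal{X}\subseteq[0,1]^d\setminus\partial\mathcal{W}_s$ be a set of $|T|$ points such that every cube $q\in\mathcal{W}_s$ contains a number of points of $\mathcal{X}$ lying in the interval $[s^{-k_s d}|T|-|T|^{2/3},\ s^{-k_s d}|T|+|T|^{2/3}]$. Then $G(\mathcal{X},(1+\epsilon)r^*,d)$ contains a copy of $T$.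
   Context: For a finite set $\mathcal{X}\subseteq[0,1]^d$, the geometric graph $G(\mathcal{X},\rho,d)$ has vertex set $\mathcal{X}$ and edges $xy$ for distinct $x,y\in\mathcal{X}$ with Euclidean distance at most $\rho$. $\partial\mathcal{W}_s$ denotes the union of the topological boundaries of the cubes in $\mathcal{W}_s$. $|T|$ is the number of vertices of $T$. For a rooted tree, the layer $V_i$ is the set of vertices at graph distance $i$ from the root, the height is the largest $h$ with $V_h$ nonempty, and the children of a vertex in $V_j$ are its neighbours in $V_{j+1}$. The balanced tree over $(s_i)_{i=1}^h$ is the rooted tree of height $h$ in which, for each $i\in\{1,\dots,h\}$, every vertex of $V_{i-1}$ has exactly $s_i$ children. *)

theory Defs
  imports "HOL-Analysis.Analysis" "HOL-Library.Landau_Symbols"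
begin

definition geom_edge :: "('a::metric_space) set \<Rightarrow> real \<Rightarrow> 'a \<Rightarrow> 'a \<Rightarrow> bool" where
  "geom_edge X \<rho> x y \<longleftrightarrow> x \<in> X \<and> y \<in> X \<and> x \<noteq> y \<and> dist x y \<le> \<rho>"

text \<open>The balanced tree over (s_i)_{i=1}^h: vertices are the words a_1...a_j
  (0 \<le> j \<le> h) with a_i < s_i; the root is the empty word (layer V_0), and the
  children of a word xs in V_j are the words xs @ [a] with a < s_{j+1}.\<close>
definition bal_tree_verts :: "(nat \<Rightarrow> nat) \<Rightarrow> nat \<Rightarrow> nat list set" where
  "bal_tree_verts ss h = {xs. length xs \<le> h \<and> (\<forall>j < length xs. xs ! j < ss (Suc j))}"

definition bal_tree_edge :: "(nat \<Rightarrow> nat) \<Rightarrow> nat \<Rightarrow> nat list \<Rightarrow> nat list \<Rightarrow> bool" where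
  "bal_tree_edge ss h u v \<longleftrightarrow> u \<in> bal_tree_verts ss h \<and> v \<in> bal_tree_verts ss h \<and>
     ((\<exists>a. v = u @ [a]) \<or> (\<exists>a. u = v @ [a]))"

definition contains_bal_tree ::
  "'a set \<Rightarrow> ('a \<Rightarrow> 'a \<Rightarrow> bool) \<Rightarrow> (nat \<Rightarrow> nat) \<Rightarrow> nat \<Rightarrow> bool" where
  "contains_bal_tree X E ss h \<longleftrightarrow>
     (\<exists>\<phi>. inj_on \<phi> (bal_tree_verts ss h) \<and> \<phi> ` bal_tree_verts ss h \<subseteq> X \<and>
        (\<forall>u v. bal_tree_edge ss h u v \<longrightarrow> E (\<phi> u) (\<phi> v)))"

definition tess :: "nat \<Rightarrow> nat \<Rightarrow> (real^'n) set set" where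
  "tess s k = {cbox (\<chi> i. real (j i) / real (s ^ k)) (\<chi> i. real (Suc (j i)) / real (s ^ k)) | j.
                 \<forall>i. j i < s ^ k}"

definition tess_boundary :: "nat \<Rightarrow> nat \<Rightarrow> (real^'n) set" where
  "tess_boundary s k = \<Union> (frontier ` (tess s k :: (real^'n) set set))"

definition rstar :: "nat \<Rightarrow> nat \<Rightarrow> real" where
  "rstar d h = sqrt (real d) / (2 * real h)"

definition kk :: "nat \<Rightarrow> real \<Rightarrow> nat \<Rightarrow> nat \<Rightarrow> nat" where
  "kk d \<epsilon> h s = (LEAST k::nat.
      sqrt (real d) * real s powr (1 - real k) \<le> (1 + \<epsilon>) * rstar d h \<and>
      sqrt (real d) * real s powr (- real k) < \<epsilon> * rstar d h / 8)"

end

theory Submission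
  imports Defs "HOL-Real_Asymp.Real_Asymp"
begin

text \<open>
  Let \<open>m\<close> be about \<open>\<epsilon> h / 8\<close>. The vertices of the first \<open>m\<close> levels sit at the centre of the unit
  cube, and every level-\<open>m\<close> vertex receives a target cube. During the next \<open>h - 2 m\<close> levels its
  descendants walk along the straight segment from the centre to the target; the segment has length at
  most \<open>sqrt d / 2\<close>, so the steps are shorter than \<open>r\<close> with room for the cube diameter. All but a
  \<open>2\<^sup>-\<^sup>m\<close> fraction of the vertices lie in the last \<open>m\<close> levels. They have to fill the capacity that
  the walking vertices leave in each cube exactly. To this end the cubes are ordered along a
  Hamiltonian path of the grid (a snake), the level-\<open>m\<close> vertices get their targets in this order in
  nearly equal shares, and the deep vertices, sorted by their level-\<open>m\<close> ancestor, are cut into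
  consecutive blocks of the prescribed sizes. The accumulated discrepancies are exponentially small
  relative to a block, because the number of cubes is polynomial in \<open>h\<close>; hence each deep vertex ends
  up at most one position along the snake away from its target, that is, in the target cube or one
  touching it.
\<close>

section \<open>Allocation along a Hamiltonian path of the grid\<close>

text \<open>Induction on the coordinates, the new one being the most significant digit. The old
  enumeration runs forwards in even layers and backwards in odd ones, so only the new coordinate
  changes between layers. Functions are 0 off \<open>A\<close> so that all stages live in one
  type.\<close>

lemma snake_enumeration:
  fixes n :: nat
  assumes "finite A" "n > 0"
  shows "\<exists>p :: nat \<Rightarrow> 'a \<Rightarrow> nat.
    bij_betw p {..<n ^ card A} {f. (\<forall>i\<in>A. f i < n) \<and> (\<forall>i. i \<notin> A \<longrightarrow> f i = 0)} \<and>
    (\<forall>t. Suc t < n ^ card A \<longrightarrow> (\<forall>i. \<bar>int (p t i) - int (p (Suc t) i)\<bar> \<le> 1))"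
  using assms(1)
proof (induction A rule: finite_induct)
  case empty
  have "{f :: 'a \<Rightarrow> nat. \<forall>i. f i = 0} = {\<lambda>_. 0}" by auto
  moreover have "bij_betw (\<lambda>_. \<lambda>_. 0) {..<Suc 0} {\<lambda>_::'a. 0::nat}"
    by (auto simp: bij_betw_def inj_on_def)
  ultimately show ?case by auto
next
  case (insert x A)
  define c where "c = n ^ card A"
  have c: "c > 0" using assms(2) by (simp add: c_def)
  define F where "F A = {f :: 'a \<Rightarrow> nat. (\<forall>i\<in>A. f i < n) \<and> (\<forall>i. i \<notin> A \<longrightarrow> f i = 0)}" for A
  from insert.IH obtain p where p: "bij_betw p {..<c} (F A)"
    and step: "\<And>t i. Suc t < c \<Longrightarrow> \<bar>int (p t i) - int (p (Suc t) i)\<bar> \<le> 1"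
    unfolding c_def F_def by blast
  \<comment> \<open>\<open>w v\<close> is the direction of travel in layer \<open>v\<close>: the
    identity or the reversal of \<open>{..<c}\<close>. Either is its own inverse, which gives
    bijectivity of \<open>p'\<close>.\<close>
  define w where "w v u = (if even v then u else c - 1 - u)" for v u :: nat
  define p' where "p' t = (p (w (t div c) (t mod c)))(x := t div c)" for t
  have w_less: "w v u < c" if "u < c" for v u
    using that c by (auto simp: w_def)
  have w_w: "w v (w v u) = u" if "u < c" for v u
    using that by (auto simp: w_def)
  have F_x: "p u x = 0" if "u < c" for u
    using bij_betwE[OF p] that insert.hyps by (auto simp: F_def)
  have card_ins: "n ^ card (insert x A) = n * c"
    using insert.hyps by (simp add: c_def)
  have "inj_on p' {..<n * c}"
  proof (rule inj_onI)
    fix t t' assume "t \<in> {..<n * c}" "t' \<in> {..<n * c}" and eq: "p' t = p' t'"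
    have d: "t div c = t' div c" using fun_cong[OF eq, of x] by (simp add: p'_def)
    define u u' where "u = w (t div c) (t mod c)" and "u' = w (t' div c) (t' mod c)"
    have u: "u < c" "u' < c" using c by (auto simp: u_def u'_def intro!: w_less)
    have "p u = p u'"
    proof
      fix i show "p u i = p u' i"
        using fun_cong[OF eq, of i] F_x u by (cases "i = x") (auto simp: p'_def u_def u'_def)
    qed
    hence "u = u'" using u bij_betw_imp_inj_on[OF p] by (auto dest: inj_onD)
    hence "t mod c = t' mod c" using w_w d c by (metis mod_less_divisor u_def u'_def)
    thus "t = t'" using d by (metis div_mult_mod_eq)
  qed
  moreover have "p' ` {..<n * c} = F (insert x A)"
  proof (intro equalityI subsetI)
    fix f assume "f \<in> p' ` {..<n * c}"
    then obtain t where t: "t < n * c" "f = p' t" by auto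
    have "p (w (t div c) (t mod c)) \<in> F A"
      using bij_betwE[OF p] w_less c by simp
    thus "f \<in> F (insert x A)"
      using t by (auto simp: F_def p'_def less_mult_imp_div_less)
  next
    fix f assume f: "f \<in> F (insert x A)"
    hence "f(x := 0) \<in> F A" using insert.hyps by (auto simp: F_def)
    then obtain u where u: "u < c" "p u = f(x := 0)"
      using bij_betw_imp_surj_on[OF p] by (metis imageE lessThan_iff)
    define t where "t = f x * c + w (f x) u"
    have wu: "w (f x) u < c" using u w_less by simp
    have td: "t div c = f x" "t mod c = w (f x) u" using wu by (auto simp: t_def)
    have "p' t = f" by (simp add: p'_def td w_w u)
    moreover have "f x < n" using f by (auto simp: F_def)
    hence "t < n * c"
    proof -
      have "t < Suc (f x) * c" using wu by (simp add: t_def)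
      also have "\<dots> \<le> n * c" using \<open>f x < n\<close> by (intro mult_right_mono) auto
      finally show ?thesis .
    qed
    ultimately show "f \<in> p' ` {..<n * c}" by auto
  qed
  moreover have "\<bar>int (p' t i) - int (p' (Suc t) i)\<bar> \<le> 1" for t i
  proof (cases "Suc (t mod c) = c")
    case True
    have d: "Suc t div c = Suc (t div c)" "Suc t mod c = 0"
      using True by (auto simp: div_Suc mod_Suc)
    \<comment> \<open>Consecutive layers have opposite parity, so the last place of one and the
      first place of the next are the same point of the old enumeration.\<close>
    have "w (Suc t div c) (Suc t mod c) = w (t div c) (t mod c)"
      using True by (auto simp: w_def d)
    thus ?thesis by (auto simp: p'_def d)
  next
    case False
    hence d: "Suc t div c = t div c" "Suc t mod c = Suc (t mod c)"
      by (auto simp: div_Suc mod_Suc)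
    have lt: "Suc (t mod c) < c" using False c by (metis Suc_lessI mod_less_divisor)
    show ?thesis
    proof (cases "even (t div c)")
      case True
      thus ?thesis using step[OF lt] by (auto simp: p'_def d w_def)
    next
      case odd: False
      \<comment> \<open>In an odd layer the move is from \<open>Suc u\<close> back to
        \<open>u\<close>, a reversed step of the old enumeration.\<close>
      define u where "u = c - 1 - Suc (t mod c)"
      have u: "c - 1 - t mod c = Suc u" "Suc u < c" using lt by (auto simp: u_def)
      have "w (t div c) (t mod c) = Suc u" "w (Suc t div c) (Suc t mod c) = u"
        using odd u(1) by (simp_all add: d w_def u_def)
      thus ?thesis using step[OF u(2)] by (auto simp: p'_def d abs_minus_commute)
    qed
  qed
  ultimately show ?case
    unfolding card_ins F_def[symmetric] bij_betw_def by blast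
qed

section \<open>Cutting a sorted set into consecutive blocks of prescribed sizes\<close>

lemma block_index:
  fixes \<kappa> :: "nat \<Rightarrow> nat"
  assumes "v < sum \<kappa> {..<N}"
  defines "b \<equiv> \<lambda>v. LEAST b. v < sum \<kappa> {..b}"
  shows "b v < N" "sum \<kappa> {..<b v} \<le> v" "v < sum \<kappa> {..b v}"
proof -
  have N: "N > 0" using assms(1) by (cases N) auto
  have ex: "v < sum \<kappa> {..N - 1}"
    using assms(1) N by (metis Suc_diff_1 lessThan_Suc_atMost)
  show "v < sum \<kappa> {..b v}" unfolding b_def using ex by (rule LeastI)
  have "b v \<le> N - 1" unfolding b_def using ex by (rule Least_le)
  thus "b v < N" using N by simp
  show "sum \<kappa> {..<b v} \<le> v"
  proof (cases "b v")
    case (Suc c)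
    hence "\<not> v < sum \<kappa> {..c}" unfolding b_def by (metis lessI not_less_Least)
    thus ?thesis using Suc by (simp add: lessThan_Suc_atMost)
  qed auto
qed

text \<open>Position \<open>v\<close> goes to the block whose interval between consecutive partial
  sums contains it. Partial sums are monotone, so these intervals are disjoint; blocks may be
  empty.\<close>

lemma block_allocation:
  fixes \<kappa> :: "nat \<Rightarrow> nat"
  shows "\<exists>b. (\<forall>v < sum \<kappa> {..<N}. b v < N \<and> sum \<kappa> {..<b v} \<le> v \<and> v < sum \<kappa> {..b v}) \<and>
    (\<forall>t<N. card {v. v < sum \<kappa> {..<N} \<and> b v = t} = \<kappa> t)"
proof -
  define b where "b = (\<lambda>v. LEAST b. v < sum \<kappa> {..b})"
  have b: "b v < N" "sum \<kappa> {..<b v} \<le> v" "v < sum \<kappa> {..b v}" if "v < sum \<kappa> {..<N}" for v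
    using block_index[OF that] by (auto simp: b_def)
  have mono: "sum \<kappa> {..<i} \<le> sum \<kappa> {..<j}" if "i \<le> j" for i j
    using that by (intro sum_mono2) auto
  have "{v. v < sum \<kappa> {..<N} \<and> b v = t} = {sum \<kappa> {..<t}..<sum \<kappa> {..<Suc t}}" if "t < N" for t
  proof (intro equalityI subsetI)
    fix v assume "v \<in> {v. v < sum \<kappa> {..<N} \<and> b v = t}"
    thus "v \<in> {sum \<kappa> {..<t}..<sum \<kappa> {..<Suc t}}" using b by (auto simp: lessThan_Suc_atMost)
  next
    fix v assume v: "v \<in> {sum \<kappa> {..<t}..<sum \<kappa> {..<Suc t}}"
    have vN: "v < sum \<kappa> {..<N}" using v mono[of "Suc t" N] that by auto
    have "\<not> b v < t" using b(3)[OF vN] mono[of "Suc (b v)" t] v by (auto simp: lessThan_Suc_atMost)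
    moreover have "\<not> t < b v" using b(2)[OF vN] mono[of "Suc t" "b v"] v by auto
    ultimately show "v \<in> {v. v < sum \<kappa> {..<N} \<and> b v = t}" using vN by auto
  qed
  hence "card {v. v < sum \<kappa> {..<N} \<and> b v = t} = \<kappa> t" if "t < N" for t
    using that by simp
  thus ?thesis using b by blast
qed

text \<open>Sorts \<open>A\<close> by the value of \<open>f\<close>: each fibre fills a window of
  \<open>S\<close> consecutive positions, and division with remainder by \<open>S\<close> recovers
  the fibre and the place in it.\<close>

lemma enumerate_by_fibres:
  fixes f :: "'a \<Rightarrow> nat"
  assumes "finite A" and f: "f ` A \<subseteq> {..<B}"
    and fib: "\<And>u. u < B \<Longrightarrow> card {x \<in> A. f x = u} = S"
  shows "\<exists>pos. bij_betw pos A {..<B * S} \<and> (\<forall>x\<in>A. f x * S \<le> pos x \<and> pos x < Suc (f x) * S)"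
proof -
  have "\<exists>w. bij_betw w {x \<in> A. f x = u} {..<S}" if "u < B" for u
    using fib[OF that] assms(1) by (intro finite_same_card_bij) auto
  then obtain w where w: "\<And>u. u < B \<Longrightarrow> bij_betw (w u) {x \<in> A. f x = u} {..<S}"
    by metis
  define pos where "pos x = f x * S + w (f x) x" for x
  have wl: "w (f x) x < S" if "x \<in> A" for x
    using bij_betwE[OF w[of "f x"]] f that by auto
  have div: "pos x div S = f x" "pos x mod S = w (f x) x" if "x \<in> A" for x
    using wl[OF that] by (auto simp: pos_def)
  have "inj_on pos A"
  proof (rule inj_onI)
    fix x y assume xy: "x \<in> A" "y \<in> A" "pos x = pos y"
    hence "f x = f y" "w (f x) x = w (f x) y" using div by metis+
    thus "x = y" using w[of "f x"] xy f by (auto simp: bij_betw_def inj_on_def)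
  qed
  moreover have "pos ` A = {..<B * S}"
  proof (intro equalityI subsetI)
    fix v assume "v \<in> pos ` A"
    then obtain x where x: "x \<in> A" "v = pos x" by auto
    have "v < Suc (f x) * S" using wl x by (simp add: pos_def)
    also have "\<dots> \<le> B * S" using f x by (intro mult_right_mono) auto
    finally show "v \<in> {..<B * S}" by simp
  next
    fix v assume "v \<in> {..<B * S}"
    hence v: "v div S < B" "v mod S < S" by (auto simp: less_mult_imp_div_less intro!: mod_less_divisor gr0I)
    hence "v mod S \<in> w (v div S) ` {x \<in> A. f x = v div S}"
      using bij_betw_imp_surj_on[OF w] by blast
    then obtain x where "x \<in> A" "f x = v div S" "w (v div S) x = v mod S" by auto
    thus "v \<in> pos ` A" by (auto simp: pos_def intro!: image_eqI[of _ _ x])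
  qed
  ultimately show ?thesis using wl by (intro exI[of _ pos]) (auto simp: bij_betw_def pos_def)
qed

text \<open>\<open>A\<close> is sorted by \<open>f\<close> and cut into blocks of sizes
  \<open>\<kappa>\<close>. If all blocks had the average size, fibre \<open>u\<close> would start in
  block \<open>u * N div B\<close>. The true cuts drift by at most \<open>N * e\<close> and a fibre
  has length \<open>S\<close>; by \<open>small\<close> both together do not exceed one average
  block, so the index is off by at most 1.\<close>

lemma balanced_allocation:
  fixes f :: "'a \<Rightarrow> nat" and \<kappa> :: "nat \<Rightarrow> nat" and e :: real
  assumes fin: "finite A" and f: "f ` A \<subseteq> {..<B}"
    and fib: "\<And>u. u < B \<Longrightarrow> card {x \<in> A. f x = u} = S"
    and total: "sum \<kappa> {..<N} = card A"
    and err: "\<And>t. t < N \<Longrightarrow> \<bar>real (\<kappa> t) - real (card A) / real N\<bar> \<le> e"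
    and small: "real N * e + real S \<le> real (card A) / real N"
    and N: "N > 0"
  shows "\<exists>g. (\<forall>x\<in>A. g x < N \<and> \<bar>int (g x) - int (f x * N div B)\<bar> \<le> 1) \<and>
    (\<forall>t<N. card {x \<in> A. g x = t} = \<kappa> t)"
proof -
  obtain pos where pos: "bij_betw pos A {..<B * S}"
    and posf: "\<And>x. x \<in> A \<Longrightarrow> f x * S \<le> pos x" "\<And>x. x \<in> A \<Longrightarrow> pos x < Suc (f x) * S"
    using enumerate_by_fibres[OF fin f fib] by blast
  have cA: "card A = B * S" using bij_betw_same_card[OF pos] by simp
  obtain b where b: "\<And>v. v < card A \<Longrightarrow> b v < N" "\<And>v. v < card A \<Longrightarrow> sum \<kappa> {..<b v} \<le> v"
      "\<And>v. v < card A \<Longrightarrow> v < sum \<kappa> {..b v}"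
    and bf: "\<And>t. t < N \<Longrightarrow> card {v. v < card A \<and> b v = t} = \<kappa> t"
    using block_allocation[of \<kappa> N] unfolding total by blast
  define c where "c = real (card A) / real N"
  have e: "e \<ge> 0" using err[OF N] by linarith
  have cum: "\<bar>real (sum \<kappa> {..<t}) - real t * c\<bar> \<le> real N * e" if "t \<le> N" for t
  proof -
    have "real (sum \<kappa> {..<t}) - real t * c = (\<Sum>i<t. real (\<kappa> i) - c)"
      by (simp add: sum_subtractf)
    also have "\<bar>\<dots>\<bar> \<le> (\<Sum>i<t. e)"
      using that err by (intro order_trans[OF sum_abs] sum_mono) (auto simp: c_def)
    also have "\<dots> \<le> real N * e" using that e by (auto intro!: mult_right_mono)
    finally show ?thesis .
  qed
  have mono: "sum \<kappa> {..<i} \<le> sum \<kappa> {..<j}" if "i \<le> j" for i j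
    using that by (intro sum_mono2) auto
  have close: "\<bar>int (b (pos x)) - int (f x * N div B)\<bar> \<le> 1" if x: "x \<in> A" for x
  proof -
    define v u a where "v = pos x" and "u = f x" and "a = u * N div B"
    have v: "v < card A" using x pos cA by (auto simp: v_def bij_betw_def)
    have u: "u < B" using f x by (auto simp: u_def)
    have bN: "b v < N" using b(1)[OF v] .
    have a1: "a * B \<le> u * N" by (simp add: a_def)
    have a2: "u * N < Suc a * B" using u unfolding a_def
      by (metis dividend_less_times_div gr_zeroI mult.commute mult_Suc not_less_zero)
    have aN: "a < N" using u N by (simp add: a_def less_mult_imp_div_less mult.commute)
    \<comment> \<open>As \<open>c = B * S / N\<close>, the start \<open>u * S\<close> of the fibre
      lies between the ideal cuts \<open>a * c\<close> and \<open>(a + 1) * c\<close>.\<close>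
    have "real a * real B * real S \<le> real u * real N * real S"
      using a1 by (intro mult_right_mono) (simp_all flip: of_nat_mult)
    hence lo: "real a * c \<le> real u * real S" 
      using N by (simp add: c_def cA field_simps)
    have "real u * real N * real S \<le> real (Suc a) * real B * real S"
      using a2 by (intro mult_right_mono) (simp_all flip: of_nat_mult del: of_nat_Suc)
    hence hi: "real u * real S \<le> real (Suc a) * c"
      using N by (simp add: c_def cA field_simps)
    have v1: "real u * real S \<le> real v" 
      using posf(1)[OF x] by (simp add: v_def u_def flip: of_nat_mult)
    have "v < Suc u * S" using posf(2)[OF x] by (simp add: v_def u_def)
    hence "real v < real (Suc u * S)" by (simp only: of_nat_less_iff)
    hence v2: "real v < real u * real S + real S" by (simp add: algebra_simps)
    \<comment> \<open>Otherwise cut \<open>a + 2\<close> would be at or before \<open>v\<close>,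
      although \<open>v\<close> is less than \<open>S\<close> beyond \<open>(a + 1) * c\<close>:
      this forces \<open>c < N * e + S\<close>.\<close>
    have "\<not> b v \<ge> a + 2"
    proof
      assume *: "b v \<ge> a + 2"
      have "real (sum \<kappa> {..<a + 2}) \<le> real v"
        using mono[OF *] b(2)[OF v] by (simp only: of_nat_le_iff)
      moreover have "real (sum \<kappa> {..<a + 2}) \<ge> real (a + 2) * c - real N * e"
        using cum[of "a + 2"] * bN by linarith
      ultimately have "real (a + 2) * c - real N * e < real (Suc a) * c + real S"
        using v2 hi by linarith
      thus False using small by (simp add: algebra_simps flip: c_def)
    qed
    \<comment> \<open>Otherwise \<open>v\<close> would precede cut \<open>a - 1\<close>, although
      \<open>v\<close> is at least \<open>a * c\<close>: this forces
      \<open>c < N * e\<close>.\<close>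
    moreover have "\<not> b v + 2 \<le> a"
    proof
      assume *: "b v + 2 \<le> a"
      have "v < sum \<kappa> {..<a - 1}"
      proof -
        have "Suc (b v) \<le> a - 1" using * by simp
        thus ?thesis using mono[of "Suc (b v)" "a - 1"] b(3)[OF v] unfolding lessThan_Suc_atMost by linarith
      qed
      hence "real v < real (sum \<kappa> {..<a - 1})" by (simp only: of_nat_less_iff)
      moreover have "real (sum \<kappa> {..<a - 1}) \<le> real (a - 1) * c + real N * e"
        using cum[of "a - 1"] aN by linarith
      moreover have "real (a - 1) = real a - 1" using * by simp
      ultimately have "real a * c < (real a - 1) * c + real N * e" using v1 lo by auto
      thus False using small by (simp add: algebra_simps flip: c_def)
    qed
    ultimately show ?thesis by (simp add: v_def u_def a_def)
  qed
  have "card {x \<in> A. b (pos x) = t} = \<kappa> t" if "t < N" for t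
  proof -
    have "pos ` {x \<in> A. b (pos x) = t} = {v \<in> pos ` A. b v = t}" by blast
    also have "\<dots> = {v. v < card A \<and> b v = t}"
      using pos by (simp add: bij_betw_def cA)
    finally have "bij_betw pos {x \<in> A. b (pos x) = t} {v. v < card A \<and> b v = t}"
      using bij_betw_subset[OF pos] by (metis (no_types, lifting) mem_Collect_eq subsetI)
    thus ?thesis using bf[OF that] by (simp add: bij_betw_same_card)
  qed
  moreover have "b (pos x) < N" if "x \<in> A" for x
    using b(1) pos that cA by (auto simp: bij_betw_def)
  ultimately show ?thesis using close by (intro exI[of _ "\<lambda>x. b (pos x)"]) auto
qed

section \<open>Levels of the balanced tree\<close>

definition level :: "(nat \<Rightarrow> nat) \<Rightarrow> nat \<Rightarrow> nat list set" where
  "level ss l = {xs. length xs = l \<and> (\<forall>j<l. xs ! j < ss (Suc j))}"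

lemma bal_tree_verts_eq: "bal_tree_verts ss h = (\<Union>l\<le>h. level ss l)"
  by (auto simp: bal_tree_verts_def level_def)

lemma level_Suc: "level ss (Suc l) = (\<lambda>(xs, a). xs @ [a]) ` (level ss l \<times> {..<ss (Suc l)})"
proof (intro equalityI subsetI)
  fix ys assume ys: "ys \<in> level ss (Suc l)"
  hence "ys \<noteq> []" by (auto simp: level_def)
  then obtain xs a where ysa: "ys = xs @ [a]" by (metis append_butlast_last_id)
  have "xs ! j < ss (Suc j)" if "j < l" for j
    using ys that by (auto simp: level_def ysa nth_append dest!: spec[of _ j])
  moreover have "a < ss (Suc l)" using ys by (auto simp: level_def ysa nth_append dest!: spec[of _ l])
  ultimately have "xs \<in> level ss l" "a < ss (Suc l)" using ys by (auto simp: level_def ysa)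
  thus "ys \<in> (\<lambda>(xs, a). xs @ [a]) ` (level ss l \<times> {..<ss (Suc l)})" by (auto simp: ysa)
qed (auto simp: level_def nth_append less_Suc_eq)

lemma level_0: "level ss 0 = {[]}"
  by (auto simp: level_def)

lemma finite_level: "finite (level ss l)"
  by (induction l) (simp_all add: level_0 level_Suc)

lemma card_level_Suc: "card (level ss (Suc l)) = card (level ss l) * ss (Suc l)"
proof -
  have "inj_on (\<lambda>(xs, a). xs @ [a]) (level ss l \<times> {..<ss (Suc l)})"
    by (auto simp: inj_on_def)
  thus ?thesis by (simp add: level_Suc card_image card_cartesian_product)
qed

lemma finite_bal_tree_verts: "finite (bal_tree_verts ss h)"
  by (simp add: bal_tree_verts_eq finite_level)

lemma card_level_mono:
  assumes "\<And>i. i \<in> {1..h} \<Longrightarrow> 2 \<le> ss i" "k + l \<le> h"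
  shows "card (level ss k) * 2 ^ l \<le> card (level ss (k + l))"
  using assms(2)
proof (induction l)
  case (Suc l)
  have "card (level ss k) * 2 ^ Suc l = card (level ss k) * 2 ^ l * 2" by simp
  also have "\<dots> \<le> card (level ss (k + l)) * ss (Suc (k + l))"
    using Suc assms(1)[of "Suc (k + l)"] by (intro mult_mono) auto
  finally show ?case by (simp add: card_level_Suc)
qed simp

text \<open>Levels at least double in size, so the levels above a given one add up like a geometric
  series.\<close>

lemma card_below_level:
  assumes "\<And>i. i \<in> {1..h} \<Longrightarrow> 2 \<le> ss i" "k \<le> h"
  shows "card (\<Union>l<k. level ss l) \<le> card (level ss k)"
  using assms(2)
proof (induction k)
  case (Suc k)
  have "card (\<Union>l<Suc k. level ss l) \<le> card (\<Union>l<k. level ss l) + card (level ss k)"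
    using card_Un_le[of "level ss k" "\<Union>l<k. level ss l"] by (simp add: lessThan_Suc add.commute)
  also have "\<dots> \<le> card (level ss k) * 2 ^ 1" using Suc by simp
  also have "\<dots> \<le> card (level ss (k + 1))" using Suc.prems by (intro card_level_mono assms) auto
  finally show ?case by simp
qed simp

text \<open>The shallow levels together are no larger than level \<open>h - m\<close>, whose
  vertices have at least \<open>2 ^ m\<close> descendants each on level \<open>h\<close>.\<close>

lemma card_shallow:
  assumes "\<And>i. i \<in> {1..h} \<Longrightarrow> 2 \<le> ss i" "m \<le> h"
  shows "card {xs \<in> bal_tree_verts ss h. length xs < h - m} * 2 ^ m \<le> card (bal_tree_verts ss h)"
proof -
  have "{xs \<in> bal_tree_verts ss h. length xs < h - m} = (\<Union>l<h - m. level ss l)"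
    by (auto simp: bal_tree_verts_def level_def)
  hence "card {xs \<in> bal_tree_verts ss h. length xs < h - m} * 2 ^ m \<le> card (level ss (h - m)) * 2 ^ m"
    using card_below_level[of h ss "h - m"] assms by (metis diff_le_self mult_le_mono1)
  also have "\<dots> \<le> card (level ss (h - m + m))" using assms by (intro card_level_mono[of h]) auto
  also have "\<dots> \<le> card (bal_tree_verts ss h)"
    using assms(2) by (intro card_mono finite_bal_tree_verts) (auto simp: bal_tree_verts_eq)
  finally show ?thesis .
qed

lemma card_bal_tree_verts_ge:
  assumes "\<And>i. i \<in> {1..h} \<Longrightarrow> 2 \<le> ss i"
  shows "2 ^ h \<le> card (bal_tree_verts ss h)"
proof -
  have "2 ^ h \<le> card (level ss (0 + h))"
    using card_level_mono[of h ss 0 h] assms by (simp add: level_0)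
  also have "\<dots> \<le> card (bal_tree_verts ss h)"
    by (intro card_mono finite_bal_tree_verts) (auto simp: bal_tree_verts_eq)
  finally show ?thesis .
qed

text \<open>Branching depends only on the depth, so exchanging the prefix \<open>u\<close> for
  \<open>u'\<close> is a bijection between the two subtrees.\<close>

lemma card_deep_fibre_eq:
  assumes "u \<in> level ss m" "u' \<in> level ss m" "m \<le> k"
  shows "card {xs \<in> bal_tree_verts ss h. k \<le> length xs \<and> take m xs = u} =
    card {xs \<in> bal_tree_verts ss h. k \<le> length xs \<and> take m xs = u'}"
proof -
  have *: "u' @ drop m xs \<in> {xs \<in> bal_tree_verts ss h. k \<le> length xs \<and> take m xs = u'}"
    if "u' \<in> level ss m" "xs \<in> bal_tree_verts ss h" "k \<le> length xs" for u' xs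
    using that assms(3) by (auto simp: bal_tree_verts_def level_def nth_append)
  have **: "u @ drop m xs = xs" if "take m xs = u" for m and u xs :: "nat list"
    using that append_take_drop_id by metis
  show ?thesis
    by (rule bij_betw_same_card[of "\<lambda>xs. u' @ drop m xs"],
        rule bij_betw_byWitness[where f' = "\<lambda>xs. u @ drop m xs"])
      (use assms * in \<open>auto simp: level_def intro: **\<close>)
qed

lemma take_in_level:
  assumes "xs \<in> bal_tree_verts ss h" "m \<le> length xs"
  shows "take m xs \<in> level ss m"
  using assms by (auto simp: bal_tree_verts_def level_def)

section \<open>The grid of cubes\<close>

definition cube :: "nat \<Rightarrow> ('n \<Rightarrow> nat) \<Rightarrow> (real^'n) set" where
  "cube n j = cbox (\<chi> i. real (j i) / real n) (\<chi> i. real (Suc (j i)) / real n)"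

text \<open>Picks one cube for points lying in several. The \<open>min\<close> covers the upper
  faces of the unit cube, where the floor would give \<open>n\<close>.\<close>

definition cell :: "nat \<Rightarrow> real^'n \<Rightarrow> 'n \<Rightarrow> nat" where
  "cell n x i = min (n - 1) (nat \<lfloor>real n * x $ i\<rfloor>)"

lemma mem_cube:
  "x \<in> cube n j \<longleftrightarrow> (\<forall>i. real (j i) / real n \<le> x $ i \<and> x $ i \<le> (real (j i) + 1) / real n)"
  by (auto simp: cube_def mem_box_cart add.commute)

lemma cell_less: "n > 0 \<Longrightarrow> cell n x i < n"
  by (auto simp: cell_def min_def)

lemma in_cube_cell:
  assumes "n > 0" "x \<in> cbox 0 1"
  shows "x \<in> cube n (cell n x)"
  unfolding mem_cube
proof (intro allI)
  fix i
  have x: "0 \<le> x $ i" "x $ i \<le> 1" using assms(2) by (auto simp: mem_box_cart)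
  have "0 \<le> \<lfloor>real n * x $ i\<rfloor>" using x by simp
  hence r: "real (nat \<lfloor>real n * x $ i\<rfloor>) = of_int \<lfloor>real n * x $ i\<rfloor>" by simp
  have up: "real n * x $ i \<le> real n" using x assms(1) by (simp add: mult_left_le)
  have "real (cell n x i) \<le> real n * x $ i" 
    using r by (simp add: cell_def min_def) linarith
  moreover have "real n * x $ i \<le> real (cell n x i) + 1"
    using r up assms(1) by (auto simp: cell_def min_def)
  ultimately show "real (cell n x i) / real n \<le> x $ i \<and> x $ i \<le> (real (cell n x i) + 1) / real n"
    using assms(1) by (simp add: field_simps)
qed

lemma dist_le_componentwise:
  fixes x y :: "real^'n"
  assumes "\<And>i. \<bar>x $ i - y $ i\<bar> \<le> c"
  shows "dist x y \<le> sqrt (real CARD('n)) * c"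
proof -
  have c: "c \<ge> 0" using assms[of undefined] by linarith
  have "(dist (x $ i) (y $ i))\<^sup>2 \<le> c\<^sup>2" for i
    using assms[of i] by (simp add: dist_real_def abs_le_square_iff[symmetric])
  hence "(\<Sum>i\<in>UNIV. (dist (x $ i) (y $ i))\<^sup>2) \<le> (\<Sum>i::'n\<in>UNIV. c\<^sup>2)"
    by (intro sum_mono) auto
  hence "dist x y \<le> sqrt (real CARD('n) * c\<^sup>2)"
    unfolding dist_vec_def L2_set_def by simp
  thus ?thesis using c by (simp add: real_sqrt_mult)
qed

text \<open>Used with \<open>k\<close> = 0 for a common cube, 1 for a target cube or one touching
  it, and 2 for two cubes near the same target. The second factor is the cube diameter.\<close>

lemma dist_le_cubes:
  fixes x y :: "real^'n"
  assumes "n > 0" "x \<in> cube n j" "y \<in> cube n j'"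
    and "\<And>i. \<bar>int (j i) - int (j' i)\<bar> \<le> int k"
  shows "dist x y \<le> real (k + 1) * (sqrt (real CARD('n)) / real n)"
proof -
  have "\<bar>x $ i - y $ i\<bar> \<le> real (k + 1) / real n" for i
  proof -
    have "real (j i) \<le> real n * x $ i" "real n * x $ i \<le> real (j i) + 1"
         "real (j' i) \<le> real n * y $ i" "real n * y $ i \<le> real (j' i) + 1"
      using assms(1-3) unfolding mem_cube by (auto simp: field_simps)
    moreover have "\<bar>real (j i) - real (j' i)\<bar> \<le> real k"
      using assms(4)[of i] by linarith
    ultimately have "\<bar>real n * x $ i - real n * y $ i\<bar> \<le> real (k + 1)" 
      by linarith
    hence "real n * \<bar>x $ i - y $ i\<bar> \<le> real (k + 1)"
      by (metis abs_mult abs_of_nat right_diff_distrib)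
    thus ?thesis using assms(1) by (simp add: field_simps)
  qed
  from dist_le_componentwise[of x y, OF this] show ?thesis by (simp add: mult.commute)
qed

text \<open>Off the frontiers the point is interior to both cubes, and then the integer part of
  \<open>n * x $ i\<close> determines the index.\<close>

lemma cube_open_unique:
  fixes x :: "real^'n"
  assumes "n > 0" "x \<in> cube n j" "x \<notin> frontier (cube n j)" 
    "x \<in> cube n j'" "x \<notin> frontier (cube n j')"
  shows "j = j'"
proof
  fix i
  have "x \<in> interior (cube n j)" "x \<in> interior (cube n j')"
    using assms closure_subset by (auto simp: frontier_def)
  hence "real (j i) < real n * x $ i" "real n * x $ i < real (j i) + 1"
     "real (j' i) < real n * x $ i" "real n * x $ i < real (j' i) + 1"
    using assms(1) by (auto simp: cube_def mem_box_cart field_simps)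
  thus "j i = j' i" by linarith
qed

lemma tess_eq: "tess s k = cube (s ^ k) ` {j. \<forall>i. j i < s ^ k}"
  by (auto simp: tess_def cube_def)

text \<open>Bijections between corresponding fibres glue together. This reduces the embedding to
  assigning a cube to every tree vertex so that each cube is used exactly as often as it contains
  points.\<close>

lemma ex_fibre_preserving_injection:
  assumes "finite V" "finite X" "\<And>t. card {v \<in> V. g v = t} = card {x \<in> X. c x = t}"
  shows "\<exists>\<phi>. inj_on \<phi> V \<and> \<phi> ` V \<subseteq> X \<and> (\<forall>v\<in>V. c (\<phi> v) = g v)"
proof -
  have "\<exists>\<phi>. bij_betw \<phi> {v \<in> V. g v = t} {x \<in> X. c x = t}" for t
    using assms by (intro finite_same_card_bij) auto
  then obtain \<psi> where \<psi>: "\<And>t. bij_betw (\<psi> t) {v \<in> V. g v = t} {x \<in> X. c x = t}" by metis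
  have mem: "\<psi> (g v) v \<in> X" "c (\<psi> (g v) v) = g v" if "v \<in> V" for v
    using bij_betwE[OF \<psi>[of "g v"]] that by auto
  have "inj_on (\<lambda>v. \<psi> (g v) v) V"
  proof (rule inj_onI)
    fix v w assume vw: "v \<in> V" "w \<in> V" "\<psi> (g v) v = \<psi> (g w) w"
    hence "g v = g w" using mem by metis
    thus "v = w" using vw bij_betw_imp_inj_on[OF \<psi>[of "g v"]] by (auto dest: inj_onD)
  qed
  thus ?thesis using mem by (intro exI[of _ "\<lambda>v. \<psi> (g v) v"]) auto
qed

section \<open>Straight walks from the centre of the unit cube\<close>

definition cube_centre :: "nat \<Rightarrow> ('n \<Rightarrow> nat) \<Rightarrow> real^'n" where
  "cube_centre n j = (\<chi> i. (real (j i) + 1 / 2) / real n)"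

text \<open>Subtraction is truncated here: up to step m the path rests at the centre of the unit cube.\<close>

definition path_to :: "nat \<Rightarrow> nat \<Rightarrow> real^'n \<Rightarrow> nat \<Rightarrow> real^'n" where
  "path_to m L c l = (1 / 2) *\<^sub>R 1 + (real (l - m) / real L) *\<^sub>R (c - (1 / 2) *\<^sub>R 1)"

lemma cube_centre_in_cube: "cube_centre n j \<in> cube n j"
  by (auto simp: cube_centre_def mem_cube divide_right_mono)

lemma cube_centre_in_unit_cube:
  assumes "n > 0" "\<And>i. j i < n"
  shows "cube_centre n j \<in> cbox 0 1"
proof -
  have "real (j i) + 1 / 2 \<le> real n" for i using assms(2)[of i] by linarith
  hence "(real (j i) + 1 / 2) / real n \<le> 1" for i
    using assms(1) by (simp add: divide_le_eq)
  thus ?thesis by (simp add: cube_centre_def mem_box_cart)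
qed

text \<open>Half the diagonal is what \<open>h\<close> steps of length \<open>rstar\<close> cover,
  hence the start at the centre.\<close>

lemma dist_to_centre:
  fixes c :: "real^'n"
  assumes "c \<in> cbox 0 1"
  shows "norm (c - (1 / 2) *\<^sub>R 1) \<le> sqrt (real CARD('n)) / 2"
proof -
  have "\<bar>c $ i - ((1 / 2) *\<^sub>R (1::real^'n)) $ i\<bar> \<le> 1 / 2" for i
    using assms by (auto simp: mem_box_cart abs_if dest!: spec[of _ i])
  from dist_le_componentwise[of c "(1 / 2) *\<^sub>R 1", OF this] show ?thesis by (simp add: dist_norm)
qed

lemma path_to_rest: "l \<le> m \<Longrightarrow> path_to m L c l = (1 / 2) *\<^sub>R 1"
  by (simp add: path_to_def)

lemma path_to_end: "L > 0 \<Longrightarrow> path_to m L c (m + L) = c"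
  by (simp add: path_to_def)

lemma path_to_in_unit_cube:
  fixes c :: "real^'n"
  assumes "c \<in> cbox 0 1" "l \<le> m + L"
  shows "path_to m L c l \<in> cbox 0 1"
proof -
  define t where "t = real (l - m) / real L"
  have t: "0 \<le> t" "t \<le> 1" using assms(2) by (auto simp: t_def divide_le_eq_1)
  have "path_to m L c l = (1 - t) *\<^sub>R ((1 / 2) *\<^sub>R 1) + t *\<^sub>R c"
    unfolding path_to_def t_def[symmetric]
    by (simp add: scaleR_diff_left scaleR_diff_right diff_divide_distrib)
  moreover have "(1 / 2) *\<^sub>R 1 \<in> cbox 0 (1::real^'n)" by (simp add: mem_box_cart)
  ultimately show ?thesis
    using assms(1) t convex_box(1)[of "0::real^'n" 1] by (auto intro: convexD_alt simp: convex_alt)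
qed

lemma path_to_step:
  fixes c :: "real^'n"
  assumes "c \<in> cbox 0 1" "L > 0"
  shows "dist (path_to m L c l) (path_to m L c (Suc l)) \<le> sqrt (real CARD('n)) / (2 * real L)"
proof -
  have "path_to m L c (Suc l) - path_to m L c l
      = ((real (Suc l - m) - real (l - m)) / real L) *\<^sub>R (c - (1 / 2) *\<^sub>R 1)"
    unfolding path_to_def by (simp add: algebra_simps diff_divide_distrib)
  hence "dist (path_to m L c l) (path_to m L c (Suc l))
      = \<bar>real (Suc l - m) - real (l - m)\<bar> / real L * norm (c - (1 / 2) *\<^sub>R 1)"
    by (subst dist_commute) (simp add: dist_norm)
  \<comment> \<open>The difference of the truncated subtractions is 0 while the path rests and 1
    afterwards.\<close>
  also have "\<dots> \<le> 1 / real L * (sqrt (real CARD('n)) / 2)"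
    using dist_to_centre[OF assms(1)] by (intro mult_mono divide_right_mono) auto
  finally show ?thesis by simp
qed

section \<open>Embedding into uniformly distributed points\<close>

text \<open>Provides the common fibre size that \<open>balanced_allocation\<close> asks for, with
  the level-\<open>m\<close> vertices numbered by \<open>e\<close>.\<close>

lemma deep_fibres:
  assumes "m \<le> k" "bij_betw e (level ss m) {..<B}"
  shows "\<exists>S. \<forall>u<B. card {xs \<in> bal_tree_verts ss h. k \<le> length xs \<and> e (take m xs) = u} = S"
proof -
  define F where "F w = {xs \<in> bal_tree_verts ss h. k \<le> length xs \<and> take m xs = w}" for w
  have "\<exists>w. w \<in> level ss m \<and> {xs \<in> bal_tree_verts ss h. k \<le> length xs \<and> e (take m xs) = u} = F w"
    if "u < B" for u
  proof -
    have "u \<in> e ` level ss m"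
      using bij_betw_imp_surj_on[OF assms(2)] that by simp
    then obtain w where w: "w \<in> level ss m" "e w = u" by blast
    have "e (take m xs) = u \<longleftrightarrow> take m xs = w" if "xs \<in> bal_tree_verts ss h" "k \<le> length xs" for xs
    proof -
      have "take m xs \<in> level ss m" using take_in_level[of xs ss h m] that assms(1) by simp
      thus ?thesis using w bij_betw_imp_inj_on[OF assms(2)] by (auto dest: inj_onD)
    qed
    hence "{xs \<in> bal_tree_verts ss h. k \<le> length xs \<and> e (take m xs) = u} = F w"
      by (auto simp: F_def)
    thus ?thesis using w(1) by blast
  qed
  moreover have "card (F w) = card (F w')" if "w \<in> level ss m" "w' \<in> level ss m" for w w'
    unfolding F_def using card_deep_fibre_eq[OF that assms(1)] .
  ultimately have "card {xs \<in> bal_tree_verts ss h. k \<le> length xs \<and> e (take m xs) = u} =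
      card {xs \<in> bal_tree_verts ss h. k \<le> length xs \<and> e (take m xs) = u'}"
    if "u < B" "u' < B" for u u'
    using that by (metis (no_types, lifting))
  thus ?thesis by blast
qed

lemma card_eq_sum_card_fibres:
  assumes "finite A" "bij_betw p I J" "finite I" "\<And>x. x \<in> A \<Longrightarrow> c x \<in> J"
  shows "card A = (\<Sum>t\<in>I. card {x \<in> A. c x = p t})"
proof -
  have J: "finite J" using assms(2,3) bij_betw_finite by blast
  have "(\<Sum>t\<in>I. card {x \<in> A. c x = p t}) = (\<Sum>j\<in>J. card {x \<in> A. c x = j})"
    using sum.reindex_bij_betw[OF assms(2), of "\<lambda>j. card {x \<in> A. c x = j}"] by simp
  also have "\<dots> = (\<Sum>j\<in>J. \<Sum>x\<in>{x \<in> A. c x = j}. 1)" by simp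
  also have "\<dots> = (\<Sum>x\<in>A. 1)" using assms J by (intro sum.group) auto
  finally show ?thesis by simp
qed

lemma snake_adjacent:
  fixes p :: "nat \<Rightarrow> 'a \<Rightarrow> nat"
  assumes "\<And>t i. Suc t < N \<Longrightarrow> \<bar>int (p t i) - int (p (Suc t) i)\<bar> \<le> 1"
    and "t < N" "t' < N" "\<bar>int t - int t'\<bar> \<le> 1"
  shows "\<bar>int (p t i) - int (p t' i)\<bar> \<le> 1"
proof -
  consider "t = t'" | "t' = Suc t" | "t = Suc t'" using assms(4) by linarith
  thus ?thesis using assms(1)[of t i] assms(1)[of t' i] assms(2,3)
    by cases (auto simp: abs_minus_commute)
qed

text \<open>\<open>Nm\<close> makes both the number of shallow vertices and the number of deep
  vertices below one level-\<open>m\<close> vertex at most a fraction \<open>1 / (8 * N^2)\<close>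
  of the tree, and \<open>E\<close> bounds the count errors alike. In \<open>r\<close>, one walking
  step is followed by three cube diameters for rounding positions to cubes.\<close>

lemma contains_bal_tree_of_uniform:
  fixes X :: "(real^'n) set" and r E :: real and n :: nat
  defines "N \<equiv> n ^ CARD('n)"
  assumes ss: "\<And>i. i \<in> {1..h} \<Longrightarrow> 2 \<le> ss i"
    and n: "n > 0" and m: "2 * m < h"
    and fin: "finite X" and X01: "X \<subseteq> cbox 0 1"
    and Xopen: "\<And>x j. x \<in> X \<Longrightarrow> (\<And>i. j i < n) \<Longrightarrow> x \<notin> frontier (cube n j)"
    and cardX: "card X = card (bal_tree_verts ss h)"
    and count: "\<And>j. (\<And>i. j i < n) \<Longrightarrow>
      \<bar>real (card (X \<inter> cube n j)) - real (card (bal_tree_verts ss h)) / real N\<bar> \<le> E"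
    and E: "4 * (real N)\<^sup>2 * E \<le> real (card (bal_tree_verts ss h))"
    and Nm: "8 * N\<^sup>2 \<le> 2 ^ m"
    and r: "sqrt (real CARD('n)) / (2 * real (h - 2 * m)) + 3 * (sqrt (real CARD('n)) / real n) \<le> r"
  shows "contains_bal_tree X (geom_edge X r) ss h"
proof -
  define V where "V = bal_tree_verts ss h"
  define D where "D = {xs \<in> V. h - m \<le> length xs}"
  define Sh where "Sh = {xs \<in> V. length xs < h - m}"
  define L where "L = h - 2 * m"
  have L: "L > 0" "h - m = m + L" using m by (auto simp: L_def)
  have finV: "finite V" by (simp add: V_def finite_bal_tree_verts)
  have fin_D: "finite D" and fin_Sh: "finite Sh" using finV by (auto simp: D_def Sh_def)
  have VDS: "card V = card Sh + card D"
    using finV by (subst card_Un_disjoint[symmetric]) (auto simp: D_def Sh_def intro: arg_cong[where f = card])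
  have N: "N > 0" using n by (simp add: N_def)
  obtain p :: "nat \<Rightarrow> 'n \<Rightarrow> nat" where p: "bij_betw p {..<N} {j. \<forall>i. j i < n}"
    and step: "\<And>t i. Suc t < N \<Longrightarrow> \<bar>int (p t i) - int (p (Suc t) i)\<bar> \<le> 1"
    using snake_enumeration[of "UNIV :: 'n set" n] n unfolding N_def by auto
  have p_less: "p t i < n" if "t < N" for t i using bij_betwE[OF p] that by auto

  define B where "B = card (level ss m)"
  have "card (level ss 0) * 2 ^ m \<le> card (level ss (0 + m))"
    using m ss by (intro card_level_mono[of h]) auto
  hence B_ge: "2 ^ m \<le> B" by (simp add: level_0 B_def)
  hence B: "B > 0" by (metis gr0I not_less zero_less_power zero_less_numeral)
  obtain e where e: "bij_betw e (level ss m) {..<B}"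
    using ex_bij_betw_finite_nat[OF finite_level[of ss m]] unfolding B_def by (auto simp: atLeast0LessThan)
  define f where "f xs = e (take m xs)" for xs
  have f_less: "f xs < B" if "xs \<in> V" "m \<le> length xs" for xs
    using bij_betwE[OF e] take_in_level[of xs ss h m] that by (auto simp: f_def V_def)
  have m_le: "m \<le> h - m" using m by linarith
  obtain S where "\<forall>u<B. card {xs \<in> bal_tree_verts ss h. h - m \<le> length xs \<and> e (take m xs) = u} = S"
    using deep_fibres[OF m_le e, of h] by blast
  hence S: "card {xs \<in> D. f xs = u} = S" if "u < B" for u
    using that by (simp add: D_def f_def V_def)

  \<comment> \<open>The value at vertices above level \<open>m\<close> is immaterial: their paths still rest at the centre.\<close>
  define tgt where "tgt xs = (if length xs < m then 0 else f xs * N div B)" for xs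
  have tgt_less: "tgt xs < N" if "xs \<in> V" for xs
    using f_less[OF that] N by (auto simp: tgt_def less_mult_imp_div_less mult.commute)
  define ctr where "ctr xs = cube_centre n (p (tgt xs))" for xs
  have ctr01: "ctr xs \<in> cbox 0 1" if "xs \<in> V" for xs
    unfolding ctr_def using n p_less tgt_less[OF that] by (intro cube_centre_in_unit_cube) auto
  define P where "P xs = path_to m L (ctr xs) (length xs)" for xs
  have P01: "P xs \<in> cbox 0 1" if "xs \<in> Sh" for xs
    unfolding P_def using that L ctr01 by (intro path_to_in_unit_cube) (auto simp: Sh_def)
  \<comment> \<open>A shallow vertex is put into the cube through which its path passes at that
    moment.\<close>
  define gs where "gs xs = cell n (P xs)" for xs

  have Xcell: "{x \<in> X. cell n x = j} = X \<inter> cube n j" if j: "\<And>i. j i < n" for j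
  proof -
    have "x \<in> cube n j \<longleftrightarrow> cell n x = j" if x: "x \<in> X" for x
    proof
      assume xj: "x \<in> cube n j"
      have "x \<in> cube n (cell n x)" using in_cube_cell[OF n, of x] x X01 by auto
      moreover have "x \<notin> frontier (cube n (cell n x))" "x \<notin> frontier (cube n j)"
        using Xopen[OF x, of "cell n x"] Xopen[OF x, of j] cell_less[OF n, of x] j by simp_all
      ultimately show "cell n x = j"
        using xj by (intro cube_open_unique[OF n, of x])
    next
      assume "cell n x = j"
      thus "x \<in> cube n j" using in_cube_cell[OF n, of x] x X01 by auto
    qed
    thus ?thesis by auto
  qed

  define T where "T = real (card V)"
  define \<tau> where "\<tau> = real (card Sh)"
  have T0: "T \<ge> 0" and tau0: "\<tau> \<ge> 0" by (simp_all add: T_def \<tau>_def)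
  have E0: "E \<ge> 0" using count[of "\<lambda>_. 0"] n by auto
  have N1: "real N \<ge> 1" using N by simp
  have "card Sh * 2 ^ m \<le> card V"
    using card_shallow[of h ss m] ss m by (simp add: Sh_def V_def)
  hence "real (card Sh * 2 ^ m) \<le> real (card V)" by (simp only: of_nat_le_iff)
  hence tau2: "\<tau> * 2 ^ m \<le> T" by (simp add: \<tau>_def T_def)
  have "real (8 * N\<^sup>2) \<le> real (2 ^ m)" using Nm by (simp only: of_nat_le_iff)
  hence Nm': "8 * (real N)\<^sup>2 \<le> 2 ^ m" by simp
  have tau: "8 * (real N)\<^sup>2 * \<tau> \<le> T"
    using mult_left_mono[OF Nm', of \<tau>] tau2 by (simp add: \<tau>_def mult.commute)
  have fD: "f ` D \<subseteq> {..<B}" using f_less m_le by (auto simp: D_def)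
  have cardD: "card D = B * S"
  proof -
    obtain pos where "bij_betw pos D {..<B * S}"
      using enumerate_by_fibres[OF fin_D fD S] by blast
    thus ?thesis using bij_betw_same_card by fastforce
  qed
  \<comment> \<open>The \<open>B\<close> fibres, at least \<open>2 ^ m\<close> in number, share the
    deep vertices equally.\<close>
  have S8: "8 * (real N)\<^sup>2 * real S \<le> T"
  proof -
    have "real (2 ^ m) \<le> real B" using B_ge by (simp only: of_nat_le_iff)
    hence "8 * (real N)\<^sup>2 \<le> real B" using Nm' by (simp only: of_nat_power of_nat_numeral)
    hence "8 * (real N)\<^sup>2 * real S \<le> real B * real S" by (intro mult_right_mono) auto
    also have "\<dots> \<le> T" using VDS by (simp add: T_def cardD)
    finally show ?thesis .
  qed
  have NE: "4 * (real N)\<^sup>2 * E \<le> T" using E by (simp add: T_def V_def)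
  have cnt: "\<bar>real (card (X \<inter> cube n (p t))) - T / real N\<bar> \<le> E" if "t < N" for t
    using count[of "p t"] p_less that by (simp add: T_def V_def)

  \<comment> \<open>\<open>k\<close> is the room taken by shallow vertices and
    \<open>\<kappa>\<close> the room left for deep ones; \<open>k_le_card\<close> ensures that the
    subtraction is not truncated.\<close>
  define k where "k t = card {xs \<in> Sh. gs xs = p t}" for t
  define \<kappa> where "\<kappa> t = card (X \<inter> cube n (p t)) - k t" for t
  have k_le: "real (k t) \<le> \<tau>" for t
    unfolding k_def \<tau>_def using fin_Sh by (auto intro!: card_mono)
  have N_le_N2: "real N * y \<le> (real N)\<^sup>2 * y" if "y \<ge> 0" for y
    using N1 that by (intro mult_right_mono) (auto simp: power2_eq_square mult_le_cancel_left1)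
  have k_le_card: "k t \<le> card (X \<inter> cube n (p t))" if "t < N" for t
  proof -
    have "real N * (\<tau> + E) \<le> T"
      unfolding distrib_left using N_le_N2[OF tau0] N_le_N2[OF E0] tau NE T0 by linarith
    hence "\<tau> + E \<le> T / real N" using N by (simp add: field_simps)
    hence "real (k t) \<le> real (card (X \<inter> cube n (p t)))"
      using k_le[of t] cnt[OF that] by linarith
    thus ?thesis by simp
  qed
  have "(\<Sum>t<N. card (X \<inter> cube n (p t))) = card X"
  proof -
    have "card X = (\<Sum>t<N. card {x \<in> X. cell n x = p t})"
      using cell_less[OF n] by (intro card_eq_sum_card_fibres[OF fin p]) auto
    also have "\<dots> = (\<Sum>t<N. card (X \<inter> cube n (p t)))"
      using p_less by (intro sum.cong refl arg_cong[where f = card] Xcell) auto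
    finally show ?thesis by simp
  qed
  moreover have "(\<Sum>t<N. k t) = card Sh"
    unfolding k_def using cell_less[OF n]
    by (intro card_eq_sum_card_fibres[OF fin_Sh p, symmetric]) (auto simp: gs_def)
  ultimately have sum\<kappa>: "sum \<kappa> {..<N} = card D"
    unfolding \<kappa>_def using k_le_card VDS cardX by (subst sum_subtractf_nat) (auto simp: V_def)

  \<comment> \<open>The cube count contributes \<open>E\<close>. Both \<open>k t\<close> and the
    average \<open>\<tau> / N\<close> lie between 0 and \<open>\<tau>\<close>, so they differ by at
    most \<open>\<tau>\<close>.\<close>
  have err: "\<bar>real (\<kappa> t) - real (card D) / real N\<bar> \<le> E + \<tau>" if "t < N" for t
  proof -
    have "real (card D) / real N = T / real N - \<tau> / real N"
      using VDS by (simp add: T_def \<tau>_def add_divide_distrib)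
    moreover have "0 \<le> \<tau> / real N" "\<tau> / real N \<le> \<tau>"
      using N1 by (auto simp: \<tau>_def divide_le_eq mult_le_cancel_left1)
    moreover have "real (\<kappa> t) = real (card (X \<inter> cube n (p t))) - real (k t)"
      using k_le_card[OF that] by (simp add: \<kappa>_def of_nat_diff)
    ultimately show ?thesis using cnt[OF that] k_le[of t] by linarith
  qed
  \<comment> \<open>After multiplication by \<open>N\<close> the left side is at most half the tree,
    whereas the deep vertices make up at least seven eighths of it.\<close>
  have small: "real N * (E + \<tau>) + real S \<le> real (card D) / real N"
  proof -
    have "real N * (real N * (E + \<tau>) + real S) = (real N)\<^sup>2 * E + (real N)\<^sup>2 * \<tau> + real N * real S"
      by (simp add: power2_eq_square algebra_simps)
    also have "\<dots> \<le> T / 4 + T / 8 + T / 8"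
      using NE tau S8 N_le_N2[of "real S", OF of_nat_0_le_iff] by linarith
    also have "\<dots> \<le> T - \<tau>"
    proof -
      have "\<tau> \<le> (real N)\<^sup>2 * \<tau>" 
        using mult_right_mono[OF one_le_power[OF N1, of 2] tau0] by simp
      thus ?thesis using tau T0 by linarith
    qed
    also have "\<dots> = real (card D)" using VDS by (simp add: T_def \<tau>_def)
    finally show ?thesis using N by (simp add: pos_le_divide_eq mult.commute)
  qed
  obtain g where g: "\<And>xs. xs \<in> D \<Longrightarrow> g xs < N" 
      "\<And>xs. xs \<in> D \<Longrightarrow> \<bar>int (g xs) - int (f xs * N div B)\<bar> \<le> 1"
    and g_card: "\<And>t. t < N \<Longrightarrow> card {xs \<in> D. g xs = t} = \<kappa> t"
    using balanced_allocation[OF fin_D fD S sum\<kappa> err small N] by blast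

  define G where "G xs = (if length xs < h - m then gs xs else p (g xs))" for xs
  have G_less: "G xs i < n" if "xs \<in> V" for xs i
    using that g(1) p_less cell_less[OF n] by (auto simp: G_def gs_def D_def)
  \<comment> \<open>On grid indices, shallow and deep vertices fill the cube exactly; for all other
    indices both fibres are empty.\<close>
  have "card {xs \<in> V. G xs = j} = card {x \<in> X. cell n x = j}" for j
  proof (cases "\<forall>i. j i < n")
    case True
    hence "j \<in> p ` {..<N}" using bij_betw_imp_surj_on[OF p] by simp
    then obtain t where t: "t < N" "j = p t" by auto
    have "p (g xs) = p t \<longleftrightarrow> g xs = t" if "xs \<in> D" for xs
      using inj_on_eq_iff[OF bij_betw_imp_inj_on[OF p], of "g xs" t] g(1)[OF that] t by simp
    hence "xs \<in> {xs \<in> V. G xs = j} \<longleftrightarrow> xs \<in> {xs \<in> Sh. gs xs = p t} \<union> {xs \<in> D. g xs = t}" for xs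
      by (cases "length xs < h - m") (simp_all add: t(2) G_def Sh_def D_def cong: conj_cong)
    hence "{xs \<in> V. G xs = j} = {xs \<in> Sh. gs xs = p t} \<union> {xs \<in> D. g xs = t}" by blast
    moreover have "{xs \<in> Sh. gs xs = p t} \<inter> {xs \<in> D. g xs = t} = {}"
      by (auto simp: Sh_def D_def)
    ultimately have "card {xs \<in> V. G xs = j} = k t + \<kappa> t"
      using fin_Sh fin_D g_card[OF t(1)] by (simp add: card_Un_disjoint k_def)
    also have "\<dots> = card (X \<inter> cube n j)" using k_le_card[OF t(1)] by (simp add: \<kappa>_def t)
    finally show ?thesis using Xcell True by simp
  next
    case False
    hence "{xs \<in> V. G xs = j} = {}" "{x \<in> X. cell n x = j} = {}"
      using G_less cell_less[OF n] by auto
    thus ?thesis by (simp only: card.empty)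
  qed
  then obtain \<phi> where inj: "inj_on \<phi> V" and img: "\<phi> ` V \<subseteq> X" and \<phi>: "\<And>v. v \<in> V \<Longrightarrow> cell n (\<phi> v) = G v"
    using ex_fibre_preserving_injection[OF finV fin, of G "cell n"] by blast
  have \<phi>cube: "\<phi> v \<in> cube n (G v)" if "v \<in> V" for v
    using in_cube_cell[OF n, of "\<phi> v"] \<phi>[OF that] img X01 that by auto

  define \<delta> where "\<delta> = sqrt (real CARD('n)) / real n"
  have \<delta>0: "\<delta> \<ge> 0" by (simp add: \<delta>_def)
  define \<sigma> where "\<sigma> = sqrt (real CARD('n)) / (2 * real L)"
  have \<sigma>0: "\<sigma> \<ge> 0" by (simp add: \<sigma>_def)
  have r': "\<sigma> + 3 * \<delta> \<le> r" using r by (simp add: \<sigma>_def \<delta>_def L_def)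
  have near_P: "dist (\<phi> v) (P v) \<le> \<delta>" if "v \<in> Sh" for v
    using dist_le_cubes[OF n \<phi>cube in_cube_cell[OF n P01[OF that]], of v 0] that
    by (auto simp: \<delta>_def G_def gs_def Sh_def)
  \<comment> \<open>One position along the snake changes each coordinate by at most 1, so the
    assigned cube is the target cube or touches it.\<close>
  have deep_adj: "\<bar>int (G v i) - int (p (tgt v) i)\<bar> \<le> 1" if "v \<in> D" for v i
  proof -
    have "\<bar>int (g v) - int (tgt v)\<bar> \<le> 1" using g(2)[OF that] that m by (auto simp: tgt_def D_def)
    hence "\<bar>int (p (g v) i) - int (p (tgt v) i)\<bar> \<le> 1"
      using g(1)[OF that] tgt_less[of v] that
      by (intro snake_adjacent[of N p "g v" "tgt v"] step) (auto simp: D_def)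
    thus ?thesis using that by (simp add: G_def D_def)
  qed
  have near_ctr: "dist (\<phi> v) (ctr v) \<le> 2 * \<delta>" if "v \<in> D" for v
    using dist_le_cubes[OF n \<phi>cube cube_centre_in_cube, of v "p (tgt v)" 1] deep_adj[OF that] that
    by (auto simp: \<delta>_def ctr_def D_def)
  have edge: "dist (\<phi> v) (\<phi> (v @ [a])) \<le> r" if v: "v \<in> V" and w: "v @ [a] \<in> V" for v a
  proof -
    have tgt_eq: "tgt (v @ [a]) = tgt v" "ctr (v @ [a]) = ctr v" if "m \<le> length v"
      using that by (auto simp: tgt_def f_def ctr_def)
    consider "Suc (length v) < h - m" | "Suc (length v) = h - m" | "h - m \<le> length v" by linarith
    thus ?thesis
    proof cases
      case 1
      hence "v \<in> Sh" "v @ [a] \<in> Sh" using v w by (auto simp: Sh_def)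
      moreover have "dist (P v) (P (v @ [a])) \<le> \<sigma>"
      proof (cases "m \<le> length v")
        case True
        thus ?thesis using path_to_step[OF ctr01[OF v] L(1), of m "length v"]
          by (simp add: P_def tgt_eq \<sigma>_def)
      next
        case False
        \<comment> \<open>Parent and child are both at depth at most \<open>m\<close>, so both rest
          at the centre, even if their targets differ.\<close>
        thus ?thesis using \<sigma>0 by (simp add: P_def path_to_rest)
      qed
      ultimately show ?thesis
        using near_P[of v] near_P[of "v @ [a]"] r' \<delta>0
          dist_triangle[of "\<phi> v" "\<phi> (v @ [a])" "P v"]
          dist_triangle[of "P v" "\<phi> (v @ [a])" "P (v @ [a])"]
        by (simp add: dist_commute)
    next
      case 2
      hence mem: "v \<in> Sh" "v @ [a] \<in> D" using v w by (auto simp: Sh_def D_def)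
      have len: "m \<le> length v" "Suc (length v) = m + L" using 2 L by linarith+
      \<comment> \<open>The path of \<open>v\<close> reaches the target centre at the depth of the
        child. Rounding costs one diameter for \<open>v\<close> and two for the child.\<close>
      have "dist (P v) (ctr v) \<le> \<sigma>"
        using path_to_step[OF ctr01[OF v] L(1), of m "length v"] path_to_end[OF L(1), of m "ctr v"]
        unfolding len(2) by (simp add: P_def \<sigma>_def)
      thus ?thesis
        using near_P[OF mem(1)] near_ctr[OF mem(2)] r' tgt_eq[OF len(1)]
          dist_triangle[of "\<phi> v" "\<phi> (v @ [a])" "P v"]
          dist_triangle[of "P v" "\<phi> (v @ [a])" "ctr v"]
        by (simp add: dist_commute)
    next
      case 3
      hence mem: "v \<in> D" "v @ [a] \<in> D" using v w by (auto simp: D_def)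
      have "tgt (v @ [a]) = tgt v" using 3 m by (intro tgt_eq) auto
      \<comment> \<open>Both cubes are within 1 of the common target in each coordinate, hence
        within 2 of each other, which costs three diameters and no walking step.\<close>
      hence "\<bar>int (G v i) - int (G (v @ [a]) i)\<bar> \<le> int 2" for i
        using deep_adj[OF mem(1), of i] deep_adj[OF mem(2), of i] by simp
      from dist_le_cubes[OF n \<phi>cube[OF v] \<phi>cube[OF w] this]
      show ?thesis using r' \<sigma>0 by (simp add: \<delta>_def)
    qed
  qed
  show ?thesis
    unfolding contains_bal_tree_def V_def[symmetric]
  proof (intro exI[of _ \<phi>] conjI allI impI inj img)
    fix u v assume "bal_tree_edge ss h u v"
    hence uv: "u \<in> V" "v \<in> V" "(\<exists>a. v = u @ [a]) \<or> (\<exists>a. u = v @ [a])"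
      by (auto simp: bal_tree_edge_def V_def)
    hence "u \<noteq> v" by auto
    hence "\<phi> u \<noteq> \<phi> v" using inj uv by (auto dest: inj_onD)
    thus "geom_edge X r (\<phi> u) (\<phi> v)"
      using uv edge img unfolding geom_edge_def by (auto simp: dist_commute)
  qed
qed

section \<open>The fineness of the tessellation\<close>

text \<open>Any \<open>k\<close> with \<open>s ^ k > 16 * h * s / \<epsilon>\<close> meets both
  conditions defining \<open>kk\<close>. The least such \<open>k\<close> overshoots this threshold
  by at most a factor \<open>s\<close>, which bounds the number of cubes per side.\<close>

lemma
  assumes d: "d \<ge> 1" and h: "h \<ge> 1" and s: "s \<ge> 2" and eps: "0 < \<epsilon>" "\<epsilon> < 1"
  shows kk_fine: "sqrt (real d) / real (s ^ kk d \<epsilon> h s) < \<epsilon> * rstar d h / 8"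
    and pow_kk_le: "real (s ^ kk d \<epsilon> h s) \<le> 16 * real h * (real s)\<^sup>2 / \<epsilon>"
proof -
  define Q where "Q k \<longleftrightarrow> sqrt (real d) * real s powr (1 - real k) \<le> (1 + \<epsilon>) * rstar d h \<and>
      sqrt (real d) * real s powr (- real k) < \<epsilon> * rstar d h / 8" for k
  have kk: "kk d \<epsilon> h s = (LEAST k. Q k)" by (simp add: kk_def Q_def)
  have rs: "rstar d h > 0" using d h by (simp add: rstar_def)
  have pw: "real s powr (1 - real k) = real s / real s ^ k" "real s powr (- real k) = 1 / real s ^ k" for k
    using s by (simp_all add: powr_diff powr_minus powr_realpow inverse_eq_divide)
  \<comment> \<open>Chosen so that \<open>s ^ k > C\<close> makes even
    \<open>sqrt d * s / s ^ k\<close> smaller than \<open>\<epsilon> * rstar / 8\<close>, the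
    stricter of the two bounds.\<close>
  define C where "C = 16 * real h * real s / \<epsilon>"
  have sp: "real s > 0" "real s ^ k > 0" for k using s by simp_all
  have Q: "Q k" if "real s ^ k > C" for k
  proof -
    have lt: "16 * real h * real s < \<epsilon> * real s ^ k"
      using that eps by (simp add: C_def field_simps)
    have "sqrt (real d) * (16 * real h * real s) < sqrt (real d) * (\<epsilon> * real s ^ k)"
      using lt d by (intro mult_strict_left_mono) auto
    hence *: "sqrt (real d) * (real s / real s ^ k) < \<epsilon> * rstar d h / 8"
      using sp h by (simp add: rstar_def field_simps)
    have "\<epsilon> * rstar d h / 8 \<le> (1 + \<epsilon>) * rstar d h"
    proof -
      have "\<epsilon> * rstar d h > 0" using eps rs by simp
      thus ?thesis unfolding distrib_right using rs by linarith
    qed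
    moreover have "sqrt (real d) * (1 / real s ^ k) \<le> sqrt (real d) * (real s / real s ^ k)"
      using s by (intro mult_left_mono divide_right_mono) auto
    ultimately show ?thesis using * unfolding Q_def pw by linarith
  qed
  obtain k1 where "real s ^ k1 > C" using real_arch_pow[of "real s" C] s by auto
  define k0 where "k0 = (LEAST k. real s ^ k > C)"
  have k0: "real s ^ k0 > C" unfolding k0_def by (rule LeastI[of _ k1]) fact
  have "Q (kk d \<epsilon> h s)" unfolding kk by (rule LeastI[of _ k0]) (rule Q[OF k0])
  thus "sqrt (real d) / real (s ^ kk d \<epsilon> h s) < \<epsilon> * rstar d h / 8"
    by (simp add: Q_def pw)
  have "kk d \<epsilon> h s \<le> k0" unfolding kk by (rule Least_le) (rule Q[OF k0])
  hence "real s ^ kk d \<epsilon> h s \<le> real s ^ k0" using s by (intro power_increasing) auto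
  also have "\<dots> \<le> C * real s"
  proof (cases k0)
    case 0
    have "1 * 1 \<le> real h * real s" using h s by (intro mult_mono) auto
    hence "C \<ge> 1" using eps by (simp add: C_def field_simps)
    thus ?thesis using s 0 k0 by simp
  next
    case (Suc k)
    hence "\<not> real s ^ k > C" unfolding k0_def by (metis lessI not_less_Least)
    thus ?thesis using Suc sp by (simp add: mult.commute mult_left_mono)
  qed
  finally show "real (s ^ kk d \<epsilon> h s) \<le> 16 * real h * (real s)\<^sup>2 / \<epsilon>"
    by (simp add: C_def power2_eq_square)
qed

text \<open>Resting shortens the walk to at least \<open>(1 - \<epsilon> / 4) * h\<close> steps, so
  each has length at most \<open>(1 + 5 * \<epsilon> / 8) * rstar\<close>. The remaining
  \<open>3 * \<epsilon> / 8\<close> pays for three cube diameters.\<close>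

lemma straight_walk_steps:
  fixes d h m :: nat
  assumes eps: "0 < \<epsilon>" "\<epsilon> < 1" and h: "h \<ge> 1" and m: "real m \<le> \<epsilon> * real h / 8"
  shows "sqrt (real d) / (2 * real (h - 2 * m)) + 3 * (\<epsilon> * rstar d h / 8) \<le> (1 + \<epsilon>) * rstar d h"
proof -
  have "\<epsilon> * real h \<le> real h" using eps by (simp add: mult_left_le_one_le)
  hence m2: "2 * m \<le> h" using m by linarith
  define L where "L = real (h - 2 * m)"
  have L: "L \<ge> real h * (1 - \<epsilon> / 4)" using m m2 by (simp add: L_def of_nat_diff algebra_simps)
  have pos: "real h * (1 - \<epsilon> / 4) > 0" using eps h by simp
  have "1 \<le> (1 - \<epsilon> / 4) * (1 + 5 * \<epsilon> / 8)"
  proof -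
    have "\<epsilon> * \<epsilon> \<le> \<epsilon> * 1" using eps by (intro mult_left_mono) auto
    thus ?thesis using eps by (simp add: algebra_simps)
  qed
  hence "real h * 1 \<le> real h * ((1 - \<epsilon> / 4) * (1 + 5 * \<epsilon> / 8))" by (intro mult_left_mono) auto
  also have "\<dots> \<le> L * (1 + 5 * \<epsilon> / 8)"
    using L eps mult_right_mono[OF L, of "1 + 5 * \<epsilon> / 8"] by (simp add: mult.assoc)
  finally have "1 / L \<le> (1 + 5 * \<epsilon> / 8) / real h"
    using order_less_le_trans[OF pos L] h by (simp add: field_simps)
  hence "sqrt (real d) / 2 * (1 / L) \<le> sqrt (real d) / 2 * ((1 + 5 * \<epsilon> / 8) / real h)"
    by (intro mult_left_mono) auto
  hence "sqrt (real d) / (2 * L) \<le> (1 + 5 * \<epsilon> / 8) * rstar d h"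
    by (simp add: rstar_def mult.commute)
  thus ?thesis unfolding L_def by (simp add: algebra_simps)
qed

lemma eventually_poly_le_exp:
  fixes \<epsilon> :: real and d :: nat
  assumes "0 < \<epsilon>"
  shows "\<forall>\<^sub>F h :: nat in at_top. 8 * ((16 * real h ^ 3 / \<epsilon>) ^ d)\<^sup>2 \<le> 2 ^ nat \<lfloor>\<epsilon> * real h / 8\<rfloor>"
proof -
  \<comment> \<open>The base is the bound of \<open>pow_kk_le\<close> with \<open>s\<close> replaced
    by \<open>h\<close>; the 1 subtracted in the exponent absorbs the floor.\<close>
  have "\<forall>\<^sub>F h :: nat in at_top. 8 * ((16 * real h ^ 3 / \<epsilon>) ^ d)\<^sup>2 \<le> 2 powr (\<epsilon> * real h / 8 - 1)"
    using assms by real_asymp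
  thus ?thesis
  proof eventually_elim
    case (elim h)
    have "\<epsilon> * real h / 8 - 1 \<le> real (nat \<lfloor>\<epsilon> * real h / 8\<rfloor>)" by linarith
    hence "2 powr (\<epsilon> * real h / 8 - 1) \<le> 2 powr real (nat \<lfloor>\<epsilon> * real h / 8\<rfloor>)" by simp
    thus ?case using elim by (simp add: powr_realpow)
  qed
qed

lemma two_pow_le_square_imp:
  assumes "2 ^ k \<le> (x :: real)\<^sup>2" "x > 0"
  shows "real k \<le> 4 * ln x"
proof -
  have "ln (2 ^ k) \<le> ln (x\<^sup>2)" using assms by simp
  hence "real k * ln 2 \<le> 2 * ln x" using assms by (simp add: ln_realpow)
  moreover have "real k * (1 / 2) \<le> real k * ln 2"
    using ln2_ge_two_thirds by (intro mult_left_mono) linarith+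
  ultimately show ?thesis by linarith
qed

text \<open>The cube root of \<open>x\<close> is at least \<open>2 ^ m\<close>. Thus the permitted
  deviation in the cube counts is exponentially small relative to the tree.\<close>

lemma powr_two_thirds_le:
  fixes x :: real
  assumes "2 ^ (3 * m) \<le> x"
  shows "2 ^ m * x powr (2 / 3) \<le> x"
proof -
  have "(0::real) < 2 ^ (3 * m)" by simp
  hence x: "x > 0" using assms by linarith
  have "(2::real) ^ m = (2 ^ (3 * m)) powr (1 / 3)"
    by (simp add: powr_powr flip: powr_realpow)
  also have "\<dots> \<le> x powr (1 / 3)" using assms by (intro powr_mono2) auto
  finally have "2 ^ m * x powr (2 / 3) \<le> x powr (1 / 3) * x powr (2 / 3)"
    by (intro mult_right_mono) auto
  also have "\<dots> = x" using x by (simp flip: powr_add)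
  finally show ?thesis .
qed

text \<open>Instantiates the embedding with \<open>n = s ^ K\<close>, error
  \<open>V powr (2 / 3)\<close> and \<open>m\<close> the floor of \<open>\<epsilon> * h / 8\<close>.
  As \<open>s \<le> h\<close>, the number of cubes is polynomial in \<open>h\<close>, and
  \<open>large\<close> compares it with \<open>2 ^ m\<close>.\<close>

lemma contains_bal_tree_tess:
  fixes X :: "(real^'n) set" and \<epsilon> :: real and h s :: nat and ss :: "nat \<Rightarrow> nat"
  defines "K \<equiv> kk CARD('n) \<epsilon> h s" and "V \<equiv> real (card (bal_tree_verts ss h))"
  assumes eps: "0 < \<epsilon>" "\<epsilon> < 1" and h: "h \<ge> 1" and s: "2 \<le> s" "s \<le> h"
    and ss: "\<And>i. i \<in> {1..h} \<Longrightarrow> 2 \<le> ss i"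
    and large: "8 * ((16 * real h ^ 3 / \<epsilon>) ^ CARD('n))\<^sup>2 \<le> 2 ^ nat \<lfloor>\<epsilon> * real h / 8\<rfloor>"
    and fin: "finite X" and X: "X \<subseteq> cbox 0 1 - tess_boundary s K"
    and cardX: "card X = card (bal_tree_verts ss h)"
    and count: "\<And>q. q \<in> (tess s K :: (real^'n) set set) \<Longrightarrow>
      \<bar>real (card (X \<inter> q)) - real s powr (- real (K * CARD('n))) * V\<bar> \<le> V powr (2 / 3)"
  shows "contains_bal_tree X (geom_edge X ((1 + \<epsilon>) * rstar CARD('n) h)) ss h"
proof -
  define n where "n = s ^ K"
  define N where "N = n ^ CARD('n)"
  define m where "m = nat \<lfloor>\<epsilon> * real h / 8\<rfloor>"
  have n: "n > 0" using s by (simp add: n_def)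
  have d: "CARD('n) \<ge> 1" by (simp add: Suc_le_eq)
  have m: "real m \<le> \<epsilon> * real h / 8"
  proof -
    have "0 \<le> \<epsilon> * real h / 8" using eps by simp
    thus ?thesis unfolding m_def by linarith
  qed
  have "\<epsilon> * real h \<le> real h" using eps by (simp add: mult_left_le_one_le)
  hence "8 * real m \<le> real h" using m by linarith
  \<comment> \<open>This gives both \<open>2 * m < h\<close> for the walk and
    \<open>3 * m \<le> h\<close> for the cube root estimate.\<close>
  hence m8: "8 * m \<le> h" by linarith
  have "real n \<le> 16 * real h * (real s)\<^sup>2 / \<epsilon>"
    unfolding n_def K_def using pow_kk_le[OF d h s(1) eps] .
  also have "\<dots> \<le> 16 * real h * (real h)\<^sup>2 / \<epsilon>"
    using s eps by (intro divide_right_mono mult_left_mono power_mono) auto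
  also have "\<dots> = 16 * real h ^ 3 / \<epsilon>" by (simp add: power2_eq_square power3_eq_cube)
  finally have "real N \<le> (16 * real h ^ 3 / \<epsilon>) ^ CARD('n)"
    unfolding N_def of_nat_power by (intro power_mono) auto
  hence "(real N)\<^sup>2 \<le> ((16 * real h ^ 3 / \<epsilon>) ^ CARD('n))\<^sup>2" by (intro power_mono) auto
  hence Nm: "8 * (real N)\<^sup>2 \<le> 2 ^ m" using large by (simp add: m_def)
  have "2 ^ (3 * m) \<le> (2::nat) ^ h" using m8 by (intro power_increasing) auto
  also have "\<dots> \<le> card (bal_tree_verts ss h)" by (rule card_bal_tree_verts_ge) (use ss in auto)
  finally have "real (2 ^ (3 * m)) \<le> V" unfolding V_def by (simp only: of_nat_le_iff)
  hence "2 ^ m * V powr (2 / 3) \<le> V" by (intro powr_two_thirds_le) simp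
  moreover have "4 * (real N)\<^sup>2 * V powr (2 / 3) \<le> 2 ^ m * V powr (2 / 3)"
  proof (intro mult_right_mono)
    have "(real N)\<^sup>2 \<ge> 0" by simp
    thus "4 * (real N)\<^sup>2 \<le> 2 ^ m" using Nm by linarith
  qed auto
  ultimately have E: "4 * (real N)\<^sup>2 * V powr (2 / 3) \<le> V" by linarith
  have fine: "sqrt (real CARD('n)) / real n < \<epsilon> * rstar CARD('n) h / 8"
    unfolding n_def K_def using kk_fine[OF d h s(1) eps] .
  have tessI: "cube n j \<in> (tess s K :: (real^'n) set set)" if "\<And>i. j i < n" for j
    using that by (auto simp: tess_eq n_def)
  have sN: "real s powr (- real (K * CARD('n))) = 1 / real N"
    unfolding powr_minus using s
    by (subst powr_realpow) (simp_all add: N_def n_def inverse_eq_divide flip: power_mult)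
  show ?thesis
  proof (rule contains_bal_tree_of_uniform[where n = n and m = m and E = "V powr (2 / 3)"])
    show "x \<notin> frontier (cube n j)" if "x \<in> X" "\<And>i. j i < n" for x j
      using X tessI[of j] that unfolding tess_boundary_def by blast
    show "\<bar>real (card (X \<inter> cube n j)) - real (card (bal_tree_verts ss h)) / real (n ^ CARD('n))\<bar>
        \<le> V powr (2 / 3)" if "\<And>i. j i < n" for j
      using count[OF tessI[of j]] that unfolding sN by (simp add: V_def N_def)
    show "8 * (n ^ CARD('n))\<^sup>2 \<le> 2 ^ m"
    proof -
      have "real (8 * N\<^sup>2) \<le> real (2 ^ m)" using Nm by simp
      thus ?thesis unfolding N_def by (simp only: of_nat_le_iff)
    qed
    show "sqrt (real CARD('n)) / (2 * real (h - 2 * m)) + 3 * (sqrt (real CARD('n)) / real n)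
        \<le> (1 + \<epsilon>) * rstar CARD('n) h"
      using fine by (intro order_trans[OF _ straight_walk_steps[OF eps h m]] add_left_mono
        mult_left_mono) auto
  qed (use E m8 h X in \<open>auto simp: n fin cardX ss V_def N_def\<close>)
qed

theorem theorem3p2:
  fixes M :: "nat \<Rightarrow> nat" and \<epsilon> :: real
  assumes M_ge2: "\<And>h. h \<ge> 1 \<Longrightarrow> 2 \<le> M h"
    and M_small: "(\<lambda>h. real (M h)) \<in> o(\<lambda>h. real h / ln (real h))"
    and eps: "0 < \<epsilon>" "\<epsilon> < 1"
  shows "\<exists>h0::nat. \<forall>h \<ge> h0.
     CARD('n) * kk CARD('n) \<epsilon> h 2 * M h \<le> h \<and>
     (\<forall>(ss :: nat \<Rightarrow> nat) (s :: nat) (X :: (real^'n) set).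
        (\<forall>i \<in> {1..h}. ss i \<in> {2..M h}) \<longrightarrow>
        s \<in> {2..M h} \<longrightarrow>
        card {i \<in> {1..CARD('n) * kk CARD('n) \<epsilon> h 2 * M h}. ss i = s}
          \<ge> CARD('n) * kk CARD('n) \<epsilon> h 2 \<longrightarrow>
        finite X \<longrightarrow>
        X \<subseteq> cbox 0 1 - tess_boundary s (kk CARD('n) \<epsilon> h s) \<longrightarrow>
        card X = card (bal_tree_verts ss h) \<longrightarrow>
        (\<forall>q \<in> (tess s (kk CARD('n) \<epsilon> h s) :: (real^'n) set set).
           real (card (X \<inter> q)) \<ge>
             real s powr (- real (kk CARD('n) \<epsilon> h s * CARD('n))) * real (card (bal_tree_verts ss h))
             - real (card (bal_tree_verts ss h)) powr (2/3) \<and>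
           real (card (X \<inter> q)) \<le>
             real s powr (- real (kk CARD('n) \<epsilon> h s * CARD('n))) * real (card (bal_tree_verts ss h))
             + real (card (bal_tree_verts ss h)) powr (2/3)) \<longrightarrow>
        contains_bal_tree X (geom_edge X ((1 + \<epsilon>) * rstar CARD('n) h)) ss h)"
proof -
  \<comment> \<open>With \<open>k \<le> 4 * ln h\<close> for \<open>k = kk d \<epsilon> h 2\<close>,
    the bound \<open>M * ln h \<le> c * h\<close> yields \<open>d * k * M \<le> h\<close>.\<close>
  define c where "c = 1 / (4 * real CARD('n))"
  have "real CARD('n) \<ge> 1" by (simp add: Suc_le_eq)
  hence "c > 0" and "c \<le> 1 / 1" unfolding c_def by (simp, intro divide_left_mono) linarith+
  hence c: "c > 0" "c \<le> 1" by simp_all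
  have "\<forall>\<^sub>F h in at_top. norm (real (M h)) \<le> c * norm (real h / ln (real h))"
    using landau_o.smallD[OF M_small c(1)] .
  moreover have "\<forall>\<^sub>F h :: nat in at_top. ln (real h) \<ge> 1" by real_asymp
  \<comment> \<open>For \<open>s = 2\<close> the bound of \<open>pow_kk_le\<close> is
    \<open>64 * h / \<epsilon>\<close>; bounding it by the square of \<open>h\<close> leads to
    \<open>k \<le> 4 * ln h\<close>.\<close>
  moreover have "\<forall>\<^sub>F h :: nat in at_top. 64 * real h / \<epsilon> \<le> (real h)\<^sup>2"
    using eps by real_asymp
  moreover note eventually_poly_le_exp[OF eps(1), of "CARD('n)"]
  moreover note eventually_ge_at_top[of "1 :: nat"]
  ultimately have "\<forall>\<^sub>F h in at_top. real (M h) * ln (real h) \<le> c * real h \<and> ln (real h) \<ge> 1 \<and>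
      64 * real h / \<epsilon> \<le> (real h)\<^sup>2 \<and> h \<ge> 1 \<and>
      8 * ((16 * real h ^ 3 / \<epsilon>) ^ CARD('n))\<^sup>2 \<le> 2 ^ nat \<lfloor>\<epsilon> * real h / 8\<rfloor>"
  proof eventually_elim
    case (elim h)
    hence "real (M h) \<le> c * (real h / ln (real h))" by simp
    hence "real (M h) \<le> c * real h / ln (real h)" by simp
    hence "real (M h) * ln (real h) \<le> c * real h" using elim(2) by (subst (asm) pos_le_divide_eq) auto
    thus ?case using elim by blast
  qed
  then obtain h0 where h0: "\<And>h. h \<ge> h0 \<Longrightarrow> real (M h) * ln (real h) \<le> c * real h \<and>
      ln (real h) \<ge> 1 \<and> 64 * real h / \<epsilon> \<le> (real h)\<^sup>2 \<and> h \<ge> 1 \<and>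
      8 * ((16 * real h ^ 3 / \<epsilon>) ^ CARD('n))\<^sup>2 \<le> 2 ^ nat \<lfloor>\<epsilon> * real h / 8\<rfloor>"
    unfolding eventually_at_top_linorder by blast
  show ?thesis
  proof (intro exI[of _ h0] allI impI conjI)
    fix h assume "h0 \<le> h"
    note h = h0[OF this]
    define k where "k = kk CARD('n) \<epsilon> h 2"
    have "real (2 ^ k) \<le> 16 * real h * (real 2)\<^sup>2 / \<epsilon>"
      unfolding k_def using h eps by (intro pow_kk_le) (auto simp: Suc_le_eq)
    hence "real k \<le> 4 * ln (real h)" using h by (intro two_pow_le_square_imp) auto
    hence "real k * real (M h) \<le> 4 * ln (real h) * real (M h)" by (intro mult_right_mono) auto
    hence "real k * real (M h) \<le> 4 * (real (M h) * ln (real h))" by (simp add: mult_ac)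
    also have "\<dots> \<le> 4 * (c * real h)" using h by simp
    finally have "real CARD('n) * (real k * real (M h)) \<le> real CARD('n) * (4 * (c * real h))"
      by (intro mult_left_mono) auto
    hence "real (CARD('n) * k * M h) \<le> real h" by (simp add: c_def)
    thus "CARD('n) * kk CARD('n) \<epsilon> h 2 * M h \<le> h" unfolding k_def by (simp only: of_nat_le_iff)
  next
    fix h :: nat and ss :: "nat \<Rightarrow> nat" and s :: nat and X :: "(real^'n) set"
    assume "h0 \<le> h" and ss: "\<forall>i\<in>{1..h}. ss i \<in> {2..M h}" and s: "s \<in> {2..M h}"
      and X: "finite X" "X \<subseteq> cbox 0 1 - tess_boundary s (kk CARD('n) \<epsilon> h s)"
        "card X = card (bal_tree_verts ss h)"
      and count: "\<forall>q\<in>(tess s (kk CARD('n) \<epsilon> h s) :: (real^'n) set set).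
           real (card (X \<inter> q)) \<ge>
             real s powr (- real (kk CARD('n) \<epsilon> h s * CARD('n))) * real (card (bal_tree_verts ss h))
             - real (card (bal_tree_verts ss h)) powr (2/3) \<and>
           real (card (X \<inter> q)) \<le>
             real s powr (- real (kk CARD('n) \<epsilon> h s * CARD('n))) * real (card (bal_tree_verts ss h))
             + real (card (bal_tree_verts ss h)) powr (2/3)"
    note h = h0[OF \<open>h0 \<le> h\<close>]
    \<comment> \<open>From \<open>ln h \<ge> 1\<close> and \<open>c \<le> 1\<close> follows
      \<open>M h \<le> h\<close>, hence \<open>s \<le> h\<close>.\<close>
    have "real (M h) * 1 \<le> real (M h) * ln (real h)" using h by (intro mult_left_mono) auto
    also have "\<dots> \<le> c * real h" using h by blast
    also have "\<dots> \<le> 1 * real h" using c by (intro mult_right_mono) auto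
    finally have "M h \<le> h" by simp
    show "contains_bal_tree X (geom_edge X ((1 + \<epsilon>) * rstar CARD('n) h)) ss h"
    proof (rule contains_bal_tree_tess[of \<epsilon> h s])
      show "\<bar>real (card (X \<inter> q)) - real s powr (- real (kk CARD('n) \<epsilon> h s * CARD('n))) *
          real (card (bal_tree_verts ss h))\<bar> \<le> real (card (bal_tree_verts ss h)) powr (2 / 3)"
        if "q \<in> tess s (kk CARD('n) \<epsilon> h s)" for q
        using bspec[OF count that] by linarith
    qed (use eps h ss s X \<open>M h \<le> h\<close> in auto)
  qed
qed

end
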